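(* In the hyperbolic Pascal triangle linked to $\{4,5\}$, for $n\ge1$ let $s_n$ be the number of elements of row $n$, and let $\varphi_n$ be the integer whose binary expansion with $s_n$ binary digits is obtained by reading the types of the elements of row $n$ from left to right and encoding type $A$ by $0$ and type $B$ by $1$, where the wingers are regarded as being of type $B$. Put $S_n=2^{s_{n+1}-s_n}$ and $\Phi_n=\varphi_{n+1}-\varphi_n$. Then $$\Phi_n=\left(\frac{S_n}{S_{n-1}}+S_n+S_{n-1}\right)\Phi_{n-1}-S_{n-1}^2\,\Phi_{n-2}\qquad(n\ge3).$$
   Context: The hyperbolic Pascal triangle linked to $\{4,5\}$ is built on an infinite graph ${\mathcal I}_{4,5}$ (cut out of the regular hyperbolic mosaic with Schläfli symbol $\{4,5\}$), whose vertices are arranged in rows $0,1,2,\dots$, each row ordered from left to right, and whose edges join only vertices of consecutive rows. It is constructed as follows. Row $0$ consists of a single vertex $V_0$. Row $1$ consists of two vertices, both joined to $V_0$. For every $j\ge1$ the leftmost and rightmost vertices of row $j$ are called wingers; every other vertex has type $A$ or type $B$. Given row $j\ge 1$, row $j+1$ is obtained by drawing from each vertex of row $j$, in left-to-right order, downward edges: $2$ from a winger, $3$ from a non-winger vertex of type $A$, $4$ from a non-winger vertex of type $B$. For any two neighbouring vertices of row $j$, the last downward edge of the left one and the first downward edge of the right one end in one common vertex of row $j+1$, which has type $A$. Each of the remaining downward edges ends in its own separate vertex of row $j+1$; among these, the end of the first edge of the leftmost vertex and the end of the last edge of the rightmost vertex are the wingers of row $j+1$, and all the others have type $B$. The left-to-right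 order of row $j+1$ is the order of the edges. For the encoding of rows, the wingers count as type $B$ (this does not change their number of downward edges). For example, row $3$ has pattern $BABAB$, so $\varphi_3=10101_2=21$. *)

theory Defs
  imports Complex_Main
begin

datatype vertex = Apex | Winger | TypeA | TypeB

fun down_degree :: "vertex \<Rightarrow> nat" where
  "down_degree Apex = 2"
| "down_degree Winger = 2"
| "down_degree TypeA = 3"
| "down_degree TypeB = 4"

(* The pair (i, k) is the k-th downward edge of the i-th vertex of the row, both counted
   from 0; the list is in left-to-right order. *)
definition down_edges :: "vertex list \<Rightarrow> (nat \<times> nat) list" where
  "down_edges r = concat (map (\<lambda>i. map (\<lambda>k. (i, k)) [0..<down_degree (r ! i)]) [0..<length r])"

(* Vertices of the next row, each given as the list of the edges that end in it. Two
   consecutive edges with different upper ends are the last downward edge of a vertex and the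
   first downward edge of its right neighbour. Since all down-degrees are at least 2, an edge
   that has just been joined to its left neighbour is never the last one of its vertex. *)
fun glue :: "(nat \<times> nat) list \<Rightarrow> (nat \<times> nat) list list" where
  "glue [] = []"
| "glue [e] = [[e]]"
| "glue (e # f # es) = (if fst e \<noteq> fst f then [e, f] # glue es else [e] # glue (f # es))"

definition lower_end :: "(nat \<times> nat) list \<Rightarrow> (nat \<times> nat) list \<Rightarrow> vertex" where
  "lower_end es v =
     (if length v = 2 then TypeA
      else if v = [hd es] \<or> v = [last es] then Winger
      else TypeB)"

definition next_row :: "vertex list \<Rightarrow> vertex list" where
  "next_row r = map (lower_end (down_edges r)) (glue (down_edges r))"

fun row :: "nat \<Rightarrow> vertex list" where
  "row 0 = [Apex]"
| "row (Suc 0) = [Winger, Winger]"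
| "row (Suc (Suc j)) = next_row (row (Suc j))"

definition row_size :: "nat \<Rightarrow> nat" where
  "row_size n = length (row n)"

(* Wingers are encoded like vertices of type B. Row 0, whose vertex has no type, is never
   encoded in the recurrence. *)
definition digit :: "vertex \<Rightarrow> int" where
  "digit v = (if v = TypeA then 0 else 1)"

(* horner_sum takes the least significant digit first, whereas the leftmost vertex is the most
   significant digit. *)
definition row_code :: "nat \<Rightarrow> int" where
  "row_code n = horner_sum digit 2 (rev (row n))"

(* The difference is taken in the integers, as natural-number subtraction would truncate. *)
definition S :: "nat \<Rightarrow> real" where
  "S n = 2 powi (int (row_size (n + 1)) - int (row_size n))"

definition \<Phi> :: "nat \<Rightarrow> int" where
  "\<Phi> n = row_code (n + 1) - row_code n"

lemma row_1_eq_next_row: "row 1 = next_row (row 0)"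
  by (simp add: next_row_def down_edges_def lower_end_def upt_rec)

lemma row_3: "row 3 = [Winger, TypeA, TypeB, TypeA, Winger]"
  by (simp add: numeral_3_eq_3 next_row_def down_edges_def lower_end_def upt_rec)

lemma row_code_3: "row_code 3 = 21"
  by (simp add: row_code_def row_3 digit_def)

end

theory Submission
  imports Defs
begin

text \<open>
  Off the wingers, passing to the next row is a word substitution.  Attach to every non-winger
  vertex the separate ends of its inner downward edges followed by the vertex that it shares with
  its right neighbour: then \<open>A\<close> yields \<open>BA\<close> and \<open>B\<close> yields \<open>BBA\<close>; call this substitution \<open>\<tau>\<close>.  The
  only interior vertex that is missed is the leftmost one, shared by the left winger and its
  neighbour, so the interiors satisfy \<open>u' = A \<tau>(u)\<close> (\<open>next_row_wingers\<close>).  Starting from the empty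
  interior of row 1, this makes every interior a prefix of the next one, and the appended blocks
  are the iterates \<open>a\<^sub>n = \<tau>\<^sup>n(A)\<close> (\<open>interior_extends\<close>).

  With \<open>b\<^sub>n = \<tau>\<^sup>n(B)\<close> the blocks obey \<open>a\<^sub>n\<^sub>+\<^sub>1 = b\<^sub>n a\<^sub>n\<close> and \<open>b\<^sub>n\<^sub>+\<^sub>1 = b\<^sub>n a\<^sub>n\<^sub>+\<^sub>1\<close>.  Reading words as
  binary numbers turns concatenation into \<open>x y \<mapsto> x 2^|y| + y\<close>, and \<open>S\<^sub>n\<^sub>+\<^sub>1 = 2^|a\<^sub>n|\<close> because \<open>a\<^sub>n\<close> is
  exactly what row \<open>n + 2\<close> has in addition to row \<open>n + 1\<close>.  Three consecutive differences
  \<open>\<Phi>\<close> are therefore explicit polynomials in the five quantities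
  \<open>2^|a\<^sub>k|\<close>, \<open>2^|b\<^sub>k|\<close>, the values of \<open>a\<^sub>k\<close> and \<open>b\<^sub>k\<close>, and the value of the common prefix of the
  four rows involved; the recurrence is a polynomial identity between them.
\<close>

section \<open>The next row as a word substitution\<close>

text \<open>A shared vertex is charged to its left parent.  The one uncharged \<open>A\<close> then stands at the
  left end of the interior, so that interiors grow on the right, by low-order digits.\<close>

fun offspring :: "vertex \<Rightarrow> vertex list" where
  "offspring TypeA = [TypeB, TypeA]"
| "offspring TypeB = [TypeB, TypeB, TypeA]"
| "offspring _ = []"

definition substitute :: "vertex list \<Rightarrow> vertex list" where
  "substitute w = concat (map offspring w)"

lemma substitute_simps [simp]:
  "substitute [] = []"
  "substitute (x # w) = offspring x @ substitute w"
  "substitute (v @ w) = substitute v @ substitute w"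
  by (simp_all add: substitute_def)

lemma set_substitute: "set (substitute w) \<subseteq> {TypeA, TypeB}"
proof (induction w)
  case (Cons x w)
  then show ?case by (cases x) auto
qed simp

text \<open>The edges of a row whose vertices are numbered from \<open>i\<close>: a form of \<open>down_edges\<close> that
  admits induction along the row.\<close>

fun edges_from :: "nat \<Rightarrow> vertex list \<Rightarrow> (nat \<times> nat) list" where
  "edges_from i [] = []"
| "edges_from i (x # r) = map (Pair i) [0..<down_degree x] @ edges_from (Suc i) r"

lemma edges_from_append:
  "edges_from i (r @ r') = edges_from i r @ edges_from (i + length r) r'"
  by (induction r arbitrary: i) simp_all

lemma down_edges_eq: "down_edges r = edges_from 0 r"
proof -
  have "concat (map (\<lambda>j. map (Pair (i + j)) [0..<down_degree (r ! j)]) [0..<length r])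
          = edges_from i r" for i
  proof (induction r arbitrary: i)
    case (Cons x r)
    have "[0..<length (x # r)] = 0 # map Suc [0..<length r]"
      by (simp add: upt_conv_Cons map_Suc_upt del: upt_Suc)
    with Cons.IH[of "Suc i"] show ?case
      by (simp add: comp_def del: upt_Suc)
  qed simp
  from this[of 0] show ?thesis by (simp add: down_edges_def)
qed

text \<open>Gluing is followed from a position where the last edge \<open>(i, d)\<close> of a vertex is still pending:
  it is about to be joined to the first edge of the right neighbour.  After each interior vertex
  such a position recurs, which gives the induction.  The list \<open>es\<close> stands for all edges of the
  row; the hypotheses on it ensure that, of the edges to the right of vertex \<open>i\<close>, only the very
  last one leads to a winger.\<close>

lemma glue_pending:
  assumes "set u \<subseteq> {TypeA, TypeB}"
    and "fst (hd es) \<le> i"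
    and "last es = (i + length u + 1, 1)"
  shows "map (lower_end es) (glue ((i, d) # edges_from (Suc i) (u @ [Winger])))
           = TypeA # substitute u @ [Winger]"
  using assms
proof (induction u arbitrary: i d)
  case Nil
  then show ?case by (simp add: upt_rec lower_end_def)
next
  case (Cons x u)
  have inner: "lower_end es [(Suc i, k)] = TypeB" for k
  proof -
    have "(Suc i, k) \<noteq> hd es" using Cons.prems(2) by (metis fst_conv not_less_eq_eq order_refl)
    then show ?thesis using Cons.prems(3) by (simp add: lower_end_def)
  qed
  have IH: "map (lower_end es) (glue ((Suc i, e) # edges_from (Suc (Suc i)) (u @ [Winger])))
              = TypeA # substitute u @ [Winger]" for e
    using Cons.prems by (intro Cons.IH) auto
  from Cons.prems consider "x = TypeA" | "x = TypeB" by auto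
  then show ?case
    using IH inner by cases (simp_all add: upt_rec lower_end_def[of es "[_, _]"])
qed

lemma next_row_wingers:
  assumes "set u \<subseteq> {TypeA, TypeB}"
  shows "next_row (Winger # u @ [Winger]) = Winger # TypeA # substitute u @ [Winger]"
proof -
  define es where "es = edges_from 0 (Winger # u @ [Winger])"
  have es: "es = (0, 0) # (0, 1) # edges_from (Suc 0) (u @ [Winger])"
    by (simp add: es_def upt_rec)
  have last: "last es = (0 + length u + 1, 1)"
    by (simp add: es edges_from_append upt_rec)
  have "map (lower_end es) (glue ((0, 1) # edges_from (Suc 0) (u @ [Winger])))
          = TypeA # substitute u @ [Winger]"
    using assms last by (intro glue_pending) (auto simp: es)
  moreover have "glue es = [(0, 0)] # glue ((0, 1) # edges_from (Suc 0) (u @ [Winger]))"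
    by (simp add: es)
  moreover have "lower_end es [(0, 0)] = Winger"
    by (simp add: lower_end_def es)
  ultimately have "map (lower_end es) (glue es) = Winger # TypeA # substitute u @ [Winger]"
    by simp
  then show ?thesis
    unfolding next_row_def down_edges_eq es_def .
qed

section \<open>Block structure of the rows\<close>

definition block :: "vertex \<Rightarrow> nat \<Rightarrow> vertex list" where
  "block x n = (substitute ^^ n) [x]"

lemma substitute_pow_append:
  "(substitute ^^ n) (v @ w) = (substitute ^^ n) v @ (substitute ^^ n) w"
  by (induction n) simp_all

lemma block_Suc: "block x (Suc n) = (substitute ^^ n) (offspring x)"
  by (simp add: block_def funpow_swap1)

lemma block_A_Suc: "block TypeA (Suc n) = block TypeB n @ block TypeA n"
  using substitute_pow_append[of n "[TypeB]" "[TypeA]"]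
  by (simp add: block_Suc) (simp add: block_def)

lemma block_B_Suc: "block TypeB (Suc n) = block TypeB n @ block TypeA (Suc n)"
  using substitute_pow_append[of n "[TypeB]" "[TypeB, TypeA]"]
  by (simp add: block_Suc) (simp add: block_def)

text \<open>Indices are shifted by one against the rows: \<open>interior n\<close> lies between the wingers of row
  \<open>n + 1\<close>.\<close>

fun interior :: "nat \<Rightarrow> vertex list" where
  "interior 0 = []"
| "interior (Suc n) = TypeA # substitute (interior n)"

lemma set_interior: "set (interior n) \<subseteq> {TypeA, TypeB}"
  using set_substitute by (cases n) auto

lemma row_Suc: "row (Suc n) = Winger # interior n @ [Winger]"
  by (induction n) (simp_all add: next_row_wingers set_interior)

text \<open>Both \<open>interior (n + 2)\<close> and \<open>interior (n + 1)\<close> arise from their predecessors by the same map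
  \<open>u \<mapsto> A \<tau>(u)\<close>, so an extension by \<open>w\<close> becomes an extension by \<open>\<tau>(w)\<close>.\<close>

lemma interior_extends: "interior (Suc n) = interior n @ block TypeA n"
proof (induction n)
  case (Suc n)
  have "interior (Suc (Suc n)) = TypeA # substitute (interior n @ block TypeA n)"
    using Suc by simp
  then show ?case by (simp add: block_def)
qed (simp add: block_def)

section \<open>Binary values\<close>

definition word_code :: "vertex list \<Rightarrow> int" where
  "word_code w = horner_sum digit 2 (rev w)"

lemma word_code_append: "word_code (v @ w) = word_code v * 2 ^ length w + word_code w"
  by (simp add: word_code_def horner_sum_append)

lemma word_code_Winger: "word_code [Winger] = 1"
  by (simp add: word_code_def digit_def)

text \<open>The right winger ends every row, so it only contributes a doubling and a constant; the
  prefix in front of it is the part that grows by a block.\<close>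

definition prefix_code :: "nat \<Rightarrow> int" where
  "prefix_code n = word_code (Winger # interior n)"

lemma prefix_code_Suc:
  "prefix_code (Suc n) = prefix_code n * 2 ^ length (block TypeA n) + word_code (block TypeA n)"
  using word_code_append[of "Winger # interior n" "block TypeA n"]
  unfolding prefix_code_def interior_extends by simp

lemma row_code_Suc: "row_code (Suc n) = 2 * prefix_code n + 1"
  using word_code_append[of "Winger # interior n" "[Winger]"]
  unfolding row_code_def row_Suc prefix_code_def word_code_Winger
  by (simp add: word_code_def)

lemma \<Phi>_Suc: "\<Phi> (Suc n) = 2 * (prefix_code (Suc n) - prefix_code n)"
  by (simp add: \<Phi>_def row_code_Suc)

lemma S_Suc: "S (Suc n) = 2 ^ length (block TypeA n)"
proof -
  have "int (row_size (Suc n + 1)) - int (row_size (Suc n)) = int (length (block TypeA n))"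
    by (simp add: row_size_def row_Suc interior_extends del: interior.simps)
  then show ?thesis by (simp add: S_def)
qed

section \<open>The recurrence\<close>

theorem theorem4:
  fixes n :: nat
  assumes "n \<ge> 3"
  shows "real_of_int (\<Phi> n) =
           (S n / S (n - 1) + S n + S (n - 1)) * real_of_int (\<Phi> (n - 1))
           - (S (n - 1))\<^sup>2 * real_of_int (\<Phi> (n - 2))"
proof -
  obtain k where n: "n = Suc (Suc (Suc k))"
    using assms by (metis numeral_3_eq_3 add_Suc add_0 le_Suc_ex)
  define q c :: real where "q = 2 ^ length (block TypeA k)" and "c = 2 ^ length (block TypeB k)"
  define a b p where "a = real_of_int (word_code (block TypeA k))"
    and "b = real_of_int (word_code (block TypeB k))"
    and "p = real_of_int (prefix_code k)"
  note blocks = block_A_Suc block_B_Suc word_code_append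
  have "q > 0" "c > 0" by (simp_all add: q_def c_def)
  have S1: "S (n - 1) = c * q" and S0: "S n = (c\<^sup>2 * q) * (c * q)"
    by (simp_all add: n S_Suc blocks power_add q_def c_def power2_eq_square)
  have quotient: "S n / S (n - 1) = c\<^sup>2 * q"
    using \<open>q > 0\<close> \<open>c > 0\<close> unfolding S0 S1 by simp
  \<comment> \<open>The prefixes of the following rows, obtained by appending the blocks of indices
      \<open>k\<close>, \<open>k + 1\<close> and \<open>k + 2\<close>.\<close>
  define a1 where "a1 = b * q + a"
  define a2 where "a2 = (b * (c * q) + a1) * (c * q) + a1"
  define p1 where "p1 = p * q + a"
  define p2 where "p2 = p1 * (c * q) + a1"
  define p3 where "p3 = p2 * (c\<^sup>2 * q * (c * q)) + a2"
  have p1: "real_of_int (prefix_code (Suc k)) = p1"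
    by (simp add: prefix_code_Suc p1_def p_def q_def a_def)
  have p2: "real_of_int (prefix_code (Suc (Suc k))) = p2"
    by (simp add: prefix_code_Suc[of "Suc k"] p1 p2_def a1_def blocks power_add
        a_def b_def q_def c_def)
  have p3: "real_of_int (prefix_code (Suc (Suc (Suc k)))) = p3"
    by (simp add: prefix_code_Suc[of "Suc (Suc k)"] p2 p3_def a2_def a1_def blocks power_add
        a_def b_def q_def c_def power2_eq_square algebra_simps)
  have "p3 - p2 = (c\<^sup>2 * q + c\<^sup>2 * q * (c * q) + c * q) * (p2 - p1) - (c * q)\<^sup>2 * (p1 - p)"
    unfolding p3_def p2_def p1_def a2_def a1_def by algebra
  moreover have "real_of_int (\<Phi> n) = 2 * (p3 - p2)"
    and "real_of_int (\<Phi> (n - 1)) = 2 * (p2 - p1)"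
    and "real_of_int (\<Phi> (n - 2)) = 2 * (p1 - p)"
    by (simp_all add: n \<Phi>_Suc p1 p2 p3 p_def)
  ultimately have "real_of_int (\<Phi> n) =
      (c\<^sup>2 * q + c\<^sup>2 * q * (c * q) + c * q) * real_of_int (\<Phi> (n - 1))
      - (c * q)\<^sup>2 * real_of_int (\<Phi> (n - 2))"
    by algebra
  then show ?thesis
    by (simp only: quotient) (simp only: S0 S1)
qed

end
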